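(* Fix an integer $p \geq 2$. For a positive integer $n$ and an integer $k \geq 0$, let $A_k(n)$ be the set of partitions of $n$ in which exactly $k$ distinct part sizes are divisible by $2^{p}$ (each such part size possibly repeated), and let $B_k(n)$ be the set of partitions of $n$ in which exactly $k$ distinct part sizes appear at least $2^{p}$ times. Then there is a bijection between $A_k(n)$ and $B_k(n)$; in particular $|A_k(n)| = |B_k(n)|$.
   Context: A partition of $n$ is a multiset of positive integers (parts) summing to $n$. A part size $m$ is "divisible by an exponent of $2$ that is at least $p$" exactly when $2^{p} \mid m$. The number of times a part size appears in a partition is its multiplicity. *)

theory Defs
  imports Complex_Main "HOL-Library.Multiset"
begin

definition partitions :: "nat \<Rightarrow> nat multiset set" where
  "partitions n = {M. (\<forall>m \<in># M. 0 < m) \<and> sum_mset M = n}"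

definition A_parts :: "nat \<Rightarrow> nat \<Rightarrow> nat \<Rightarrow> nat multiset set" where
  "A_parts p k n = {M \<in> partitions n. card {m \<in> set_mset M. 2 ^ p dvd m} = k}"

definition B_parts :: "nat \<Rightarrow> nat \<Rightarrow> nat \<Rightarrow> nat multiset set" where
  "B_parts p k n = {M \<in> partitions n. card {m \<in> set_mset M. 2 ^ p \<le> count M m} = k}"

text \<open>By the following lemma, \<^const>\<open>card\<close> is the true cardinality of the sets above.\<close>

lemma finite_partitions: "finite (partitions n)"
proof (rule finite_subset)
  show "partitions n \<subseteq> mset ` {xs. set xs \<subseteq> {..n} \<and> length xs \<le> n}"
  proof
    fix M assume "M \<in> partitions n"
    then have pos: "\<forall>m \<in># M. 0 < m" and sum: "sum_mset M = n"
      by (auto simp: partitions_def)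
    obtain xs where xs: "M = mset xs"
      by (metis ex_mset)
    have "size M \<le> sum_mset M"
      using pos by (induction M) auto
    moreover have "m \<le> n" if "m \<in># M" for m
      using that sum by (auto dest!: multi_member_split)
    ultimately show "M \<in> mset ` {xs. set xs \<subseteq> {..n} \<and> length xs \<le> n}"
      using xs sum by auto
  qed
  show "finite (mset ` {xs. set xs \<subseteq> {..n} \<and> length xs \<le> n})"
    by (intro finite_imageI finite_lists_length_le) auto
qed

lemma finite_A_parts: "finite (A_parts p k n)"
  by (rule finite_subset[OF _ finite_partitions]) (auto simp: A_parts_def)

lemma finite_B_parts: "finite (B_parts p k n)"
  by (rule finite_subset[OF _ finite_partitions]) (auto simp: B_parts_def)

end

theory Submission
  imports Defs
begin

text \<open>
  Write \<open>d = 2 ^ p\<close>. Every partition is uniquely a \<open>d\<close>-regular partition (no part divisible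
  by \<open>d\<close>) plus \<open>d\<close> times a partition \<open>V\<close>, all parts of \<open>V\<close> being scaled by \<open>d\<close>; it is also uniquely
  a partition with all multiplicities below \<open>d\<close> plus \<open>d\<close> copies of a partition \<open>V\<close>. The statistic
  counted in \<open>A\<close>, respectively \<open>B\<close>, is the number of distinct parts of \<open>V\<close>. It therefore suffices
  that the two kinds of remainders are equinumerous for each \<open>n\<close> (Glaisher's theorem). This follows
  by strong induction from the same two decompositions: both express the number of all
  partitions of \<open>n\<close> as the same sum, in which only the term \<open>V = {#}\<close> involves \<open>n\<close> itself.
\<close>

definition regular_partitions :: "nat \<Rightarrow> nat \<Rightarrow> nat multiset set" where
  "regular_partitions d n = {M \<in> partitions n. \<forall>m \<in># M. \<not> d dvd m}"

definition bounded_partitions :: "nat \<Rightarrow> nat \<Rightarrow> nat multiset set" where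
  "bounded_partitions d n = {M \<in> partitions n. \<forall>m. count M m < d}"

text \<open>The size of \<open>V\<close> is left free. The bound ensures that
  \<open>n - d * sum_mset V\<close>, the size left for the remainder, is a true difference and not a
  truncated one.\<close>

definition scaled_partitions :: "nat \<Rightarrow> nat \<Rightarrow> nat multiset set" where
  "scaled_partitions d n = {V. (\<forall>m \<in># V. 0 < m) \<and> d * sum_mset V \<le> n}"

definition divisible_quotient :: "nat \<Rightarrow> nat multiset \<Rightarrow> nat multiset" where
  "divisible_quotient d M = image_mset (\<lambda>m. m div d) (filter_mset (\<lambda>m. d dvd m) M)"

definition count_quotient :: "nat \<Rightarrow> nat multiset \<Rightarrow> nat multiset" where
  "count_quotient d M = (\<Sum>m\<in>set_mset M. replicate_mset (count M m div d) m)"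

definition count_remainder :: "nat \<Rightarrow> nat multiset \<Rightarrow> nat multiset" where
  "count_remainder d M = (\<Sum>m\<in>set_mset M. replicate_mset (count M m mod d) m)"

lemma count_count_quotient: "count (count_quotient d M) m = count M m div d"
  by (auto simp: count_quotient_def count_sum not_in_iff if_distrib cong: if_cong)

lemma count_count_remainder: "count (count_remainder d M) m = count M m mod d"
  by (auto simp: count_remainder_def count_sum not_in_iff if_distrib cong: if_cong)

lemma finite_regular_partitions: "finite (regular_partitions d n)"
  by (rule finite_subset[OF _ finite_partitions]) (auto simp: regular_partitions_def)

lemma finite_bounded_partitions: "finite (bounded_partitions d n)"
  by (rule finite_subset[OF _ finite_partitions]) (auto simp: bounded_partitions_def)

lemma finite_scaled_partitions:
  assumes "d > 0"
  shows "finite (scaled_partitions d n)"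
proof (rule finite_subset)
  show "scaled_partitions d n \<subseteq> (\<Union>j\<le>n. partitions j)"
  proof
    fix V assume V: "V \<in> scaled_partitions d n"
    have "sum_mset V \<le> d * sum_mset V"
      using assms by simp
    also have "\<dots> \<le> n"
      using V by (simp add: scaled_partitions_def)
    finally show "V \<in> (\<Union>j\<le>n. partitions j)"
      using V by (auto simp: scaled_partitions_def partitions_def)
  qed
qed (simp add: finite_partitions)

lemma sum_mset_scale: "sum_mset (image_mset ((*) d) V) = d * sum_mset V" for d :: nat
  by (induction V) (auto simp: algebra_simps)

lemma sum_mset_repeat: "sum_mset (repeat_mset d V) = d * sum_mset V" for V :: "nat multiset"
  by (induction d) auto

lemma regular_decomposition:
  assumes "d > 0"
  shows "filter_mset (\<lambda>m. \<not> d dvd m) M + image_mset ((*) d) (divisible_quotient d M) = M"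
proof -
  have "image_mset ((*) d) (divisible_quotient d M) = filter_mset (\<lambda>m. d dvd m) M"
    unfolding divisible_quotient_def by (induction M) auto
  then show ?thesis
    using multiset_partition[of M "\<lambda>m. d dvd m"] by (simp add: add.commute)
qed

text \<open>Division with remainder by \<open>d\<close>, applied to each multiplicity.\<close>

lemma bounded_decomposition:
  "count_remainder d M + repeat_mset d (count_quotient d M) = M"
  by (rule multiset_eqI) (simp add: count_count_quotient count_count_remainder)

text \<open>Splitting off the multiples of \<open>d\<close> is a bijection onto pairs (quotient,
  regular remainder). The predicate \<open>Q\<close> lets one count serve both Glaisher's theorem,
  with \<open>Q\<close> always true, and the count of partitions with \<open>k\<close> distinct
  parts in \<open>V\<close>.\<close>

lemma card_partitions_by_divisible_quotient:
  assumes d: "d > 0"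
  shows "card {M \<in> partitions n. Q (divisible_quotient d M)} =
    (\<Sum>V | V \<in> scaled_partitions d n \<and> Q V. card (regular_partitions d (n - d * sum_mset V)))"
    (is "card ?X = _")
proof -
  let ?S = "SIGMA V:{V \<in> scaled_partitions d n. Q V}. regular_partitions d (n - d * sum_mset V)"
  let ?f = "\<lambda>(V, U). U + image_mset ((*) d) V"
  let ?g = "\<lambda>M. (divisible_quotient d M, filter_mset (\<lambda>m. \<not> d dvd m) M)"
  \<comment> \<open>The two summands do not interfere: \<open>U\<close> has no multiples of
    \<open>d\<close>, the scaled copy of \<open>V\<close> has nothing else.\<close>
  have filt: "filter_mset (\<lambda>m. \<not> d dvd m) (U + image_mset ((*) d) V) = U"
    and quot: "divisible_quotient d (U + image_mset ((*) d) V) = V"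
    if "\<forall>m \<in># U. \<not> d dvd m" for U V
  proof -
    have "filter_mset (\<lambda>m. \<not> d dvd m) U = U" "filter_mset (\<lambda>m. d dvd m) U = {#}"
      using that by (induction U) auto
    moreover have "filter_mset (\<lambda>m. \<not> d dvd m) (image_mset ((*) d) V) = {#}"
      "divisible_quotient d (image_mset ((*) d) V) = V"
      using d unfolding divisible_quotient_def by (induction V) auto
    ultimately show "filter_mset (\<lambda>m. \<not> d dvd m) (U + image_mset ((*) d) V) = U"
      "divisible_quotient d (U + image_mset ((*) d) V) = V"
      by (simp_all add: divisible_quotient_def)
  qed
  have "bij_betw ?f ?S ?X"
  proof (rule bij_betw_byWitness[where f' = ?g])
    show "\<forall>a\<in>?S. ?g (?f a) = a"
      using filt quot by (auto simp: regular_partitions_def)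
    show "\<forall>M\<in>?X. ?f (?g M) = M"
      using regular_decomposition[OF d] by simp
    show "?f ` ?S \<subseteq> ?X"
      using d quot
      by (auto simp: regular_partitions_def scaled_partitions_def partitions_def sum_mset_scale)
    show "?g ` ?X \<subseteq> ?S"
    proof
      fix x assume "x \<in> ?g ` ?X"
      then obtain M where M: "M \<in> partitions n" "Q (divisible_quotient d M)" and x: "x = ?g M"
        by blast
      have "sum_mset (filter_mset (\<lambda>m. \<not> d dvd m) M) + d * sum_mset (divisible_quotient d M) = n"
        using M(1) regular_decomposition[OF d, of M]
        by (metis (mono_tags, lifting) mem_Collect_eq partitions_def sum_mset.union sum_mset_scale)
      moreover have "\<forall>m \<in># divisible_quotient d M. 0 < m"
        using M(1) d by (auto simp: divisible_quotient_def partitions_def dvd_def)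
      ultimately show "x \<in> ?S"
        using M x by (auto simp: regular_partitions_def scaled_partitions_def partitions_def)
    qed
  qed
  then have "card ?X = card ?S"
    by (rule bij_betw_same_card[symmetric])
  also have "\<dots> = (\<Sum>V | V \<in> scaled_partitions d n \<and> Q V.
      card (regular_partitions d (n - d * sum_mset V)))"
    using finite_scaled_partitions[OF d] finite_regular_partitions by (subst card_SigmaI) auto
  finally show ?thesis .
qed

lemma card_partitions_by_count_quotient:
  assumes d: "d > 0"
  shows "card {M \<in> partitions n. Q (count_quotient d M)} =
    (\<Sum>V | V \<in> scaled_partitions d n \<and> Q V. card (bounded_partitions d (n - d * sum_mset V)))"
    (is "card ?X = _")
proof -
  let ?S = "SIGMA V:{V \<in> scaled_partitions d n. Q V}. bounded_partitions d (n - d * sum_mset V)"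
  let ?f = "\<lambda>(V, U). U + repeat_mset d V"
  let ?g = "\<lambda>M. (count_quotient d M, count_remainder d M)"
  \<comment> \<open>Uniqueness of division with remainder: the multiplicity of \<open>m\<close> in
    the sum is \<open>count U m + d * count V m\<close>, with \<open>count U m < d\<close>.\<close>
  have rem: "count_remainder d (U + repeat_mset d V) = U"
    and quot: "count_quotient d (U + repeat_mset d V) = V"
    if "\<forall>m. count U m < d" for U V
    using that d by (auto intro!: multiset_eqI simp: count_count_quotient count_count_remainder)
  have "bij_betw ?f ?S ?X"
  proof (rule bij_betw_byWitness[where f' = ?g])
    show "\<forall>a\<in>?S. ?g (?f a) = a"
      using rem quot by (auto simp: bounded_partitions_def)
    show "\<forall>M\<in>?X. ?f (?g M) = M"
      using bounded_decomposition by simp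
    show "?f ` ?S \<subseteq> ?X"
    proof
      fix x assume "x \<in> ?f ` ?S"
      then obtain V U where V: "V \<in> scaled_partitions d n" "Q V"
        and U: "U \<in> bounded_partitions d (n - d * sum_mset V)" and x: "x = U + repeat_mset d V"
        by auto
      have "\<forall>m \<in># repeat_mset d V. 0 < m"
        using V(1) by (auto simp: scaled_partitions_def simp flip: count_greater_zero_iff)
      then show "x \<in> ?X"
        using V U x quot[of U V]
        by (auto simp: bounded_partitions_def scaled_partitions_def partitions_def sum_mset_repeat)
    qed
    show "?g ` ?X \<subseteq> ?S"
    proof
      fix x assume "x \<in> ?g ` ?X"
      then obtain M where M: "M \<in> partitions n" "Q (count_quotient d M)" and x: "x = ?g M"
        by blast
      have "sum_mset (count_remainder d M) + d * sum_mset (count_quotient d M) = n"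
        using M(1) bounded_decomposition[of d M]
        by (metis (mono_tags, lifting) mem_Collect_eq partitions_def sum_mset.union sum_mset_repeat)
      \<comment> \<open>Both components thus inherit the positivity of parts from
        \<open>M\<close>.\<close>
      moreover have "m \<in># M" if "m \<in># count_quotient d M \<or> m \<in># count_remainder d M" for m
        using that count_count_quotient[of d M m] count_count_remainder[of d M m]
        by (cases "m \<in># M") (auto simp: not_in_iff simp flip: count_greater_zero_iff)
      ultimately show "x \<in> ?S"
        using M x d
        by (auto simp: bounded_partitions_def scaled_partitions_def partitions_def
            count_count_remainder)
    qed
  qed
  then have "card ?X = card ?S"
    by (rule bij_betw_same_card[symmetric])
  also have "\<dots> = (\<Sum>V | V \<in> scaled_partitions d n \<and> Q V.
      card (bounded_partitions d (n - d * sum_mset V)))"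
    using finite_scaled_partitions[OF d] finite_bounded_partitions by (subst card_SigmaI) auto
  finally show ?thesis .
qed

theorem Glaisher:
  assumes d: "d > 0"
  shows "card (regular_partitions d n) = card (bounded_partitions d n)"
proof (induction n rule: less_induct)
  case (less n)
  let ?r = "\<lambda>V. card (regular_partitions d (n - d * sum_mset V))"
  let ?b = "\<lambda>V. card (bounded_partitions d (n - d * sum_mset V))"
  let ?T = "scaled_partitions d n"
  have fin: "finite ?T" and empty: "{#} \<in> ?T"
    using finite_scaled_partitions[OF d] by (auto simp: scaled_partitions_def)
  have eq: "?r V = ?b V" if V: "V \<in> ?T - {{#}}" for V
  proof -
    have "0 < sum_mset V"
      using V by (cases V) (auto simp: scaled_partitions_def)
    \<comment> \<open>If \<open>n = 0\<close>, membership in \<open>?T\<close> would force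
      \<open>sum_mset V = 0\<close>; otherwise a positive amount is subtracted from
      \<open>n\<close>.\<close>
    then have "n - d * sum_mset V < n"
      using V d by (cases "n = 0") (auto simp: scaled_partitions_def simp del: sum_mset_0_iff)
    then show ?thesis
      by (rule less)
  qed
  \<comment> \<open>Both sums count all partitions of \<open>n\<close>.\<close>
  have "sum ?r ?T = sum ?b ?T"
    using card_partitions_by_divisible_quotient[OF d, of n "\<lambda>_. True"]
      card_partitions_by_count_quotient[OF d, of n "\<lambda>_. True"] by simp
  moreover have "sum ?r (?T - {{#}}) = sum ?b (?T - {{#}})"
    by (rule sum.cong[OF refl eq])
  ultimately have "?r {#} = ?b {#}"
    using sum.remove[OF fin empty, of ?r] sum.remove[OF fin empty, of ?b] by linarith
  then show ?case
    by simp
qed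

text \<open>Division by \<open>d\<close> is injective on multiples of \<open>d\<close>, so distinct
  part sizes stay distinct.\<close>

lemma card_set_divisible_quotient:
  "card (set_mset (divisible_quotient d M)) = card {m \<in> set_mset M. d dvd m}"
proof -
  have "inj_on (\<lambda>m. m div d) {m \<in> set_mset M. d dvd m}"
    by (rule inj_onI) (metis (mono_tags, lifting) dvd_div_eq_iff mem_Collect_eq)
  then show ?thesis
    by (simp add: divisible_quotient_def card_image)
qed

text \<open>A multiplicity has a nonzero quotient by \<open>d\<close> exactly when it is at least
  \<open>d\<close>.\<close>

lemma set_count_quotient:
  assumes "d > 0"
  shows "set_mset (count_quotient d M) = {m \<in> set_mset M. d \<le> count M m}"
  using assms
  by (auto simp: count_count_quotient div_greater_zero_iff simp flip: count_greater_zero_iff)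

theorem theorem5:
  fixes p n k :: nat
  assumes "p \<ge> 2" and "n \<ge> 1"
  shows "(\<exists>f. bij_betw f (A_parts p k n) (B_parts p k n)) \<and>
         card (A_parts p k n) = card (B_parts p k n)"
proof -
  have d: "(2::nat) ^ p > 0"
    by simp
  have "card (A_parts p k n) = card (B_parts p k n)"
    \<comment> \<open>With this \<open>Q\<close> the left-hand sides become the cardinalities of
      \<open>A_parts\<close> and \<open>B_parts\<close>, and \<open>Glaisher\<close> matches the
      sums term by term.\<close>
    using card_partitions_by_divisible_quotient[OF d, of n "\<lambda>V. card (set_mset V) = k"]
      card_partitions_by_count_quotient[OF d, of n "\<lambda>V. card (set_mset V) = k"]
    by (simp add: A_parts_def B_parts_def card_set_divisible_quotient set_count_quotient Glaisher)
  then show ?thesis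
    \<comment> \<open>The bijection is not explicit; it comes from equal finite
      cardinalities.\<close>
    using finite_same_card_bij[OF finite_A_parts finite_B_parts] by blast
qed

end
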